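(* Let $\pi=(\pi_{ij})$ be a strictly positive probability distribution on $\{1,\dots,I_1\}\times\{1,\dots,I_2\}$, $I_1,I_2\ge2$, with row and column marginals $\pi_{i+},\pi_{+j}$. Suppose that the RC($K$) model $$\pi_{ij}=\pi_{i+}\,\pi_{+j}\,G\Big(\alpha_i+\beta_j+\sum_{k=1}^K\psi_k\,\mu_{k,i}\,\nu_{k,j}\Big),\qquad 1\le i\le I_1,\ 1\le j\le I_2,$$ holds for some real parameters, and that the $F$-scaled interactions of type $LL$, $\gamma_{ij}$, are non negative for all $i<I_1$, $j<I_2$. Then the log-odds ratios of type $LG$ and those of type $GL$ are all non negative.
   Context: $\phi$ is a real-valued convex function on $[0,\infty)$, differentiable on $(0,\infty)$, with $\phi(1)=\phi'(1)=0$; $F=\phi'$ is strictly increasing on $(0,\infty)$ and $G=F^{-1}$ is its (strictly increasing) inverse. The $F$-scaled interactions of type $LL$ (local row and column logits) are, for $i<I_1$, $j<I_2$, $$\gamma_{ij}=F\!\left[\tfrac{\pi_{i+1,j+1}}{\pi_{i+1,+}\pi_{+,j+1}}\right]-F\!\left[\tfrac{\pi_{i+1,j}}{\pi_{i+1,+}\pi_{+j}}\right]-F\!\left[\tfrac{\pi_{i,j+1}}{\pi_{i+}\pi_{+,j+1}}\right]+F\!\left[\tfrac{\pi_{ij}}{\pi_{i+}\pi_{+j}}\right],$$ which under the model equals $\sum_k\psi_k(\mu_{k,i+1}-\mu_{k,i})(\nu_{k,j+1}-\nu_{k,j})$. Log-odds ratios of type $LG$ (local for rows, global for columns): for $i<I_1$,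 $j<I_2$, $$\eta_{LG}(i,j)=\log\frac{\big(\sum_{h>j}\pi_{i+1,h}\big)\big(\sum_{h\le j}\pi_{ih}\big)}{\big(\sum_{h>j}\pi_{ih}\big)\big(\sum_{h\le j}\pi_{i+1,h}\big)}.$$ Log-odds ratios of type $GL$ (global for rows, local for columns): for $i<I_1$, $j<I_2$, $$\eta_{GL}(i,j)=\log\frac{\big(\sum_{h>i}\pi_{h,j+1}\big)\big(\sum_{h\le i}\pi_{hj}\big)}{\big(\sum_{h\le i}\pi_{h,j+1}\big)\big(\sum_{h>i}\pi_{hj}\big)}.$$ *)

theory Defs
  imports "HOL-Analysis.Analysis"
begin

text \<open>
  Two-way tables are functions on pairs of natural numbers; only the entries with row index in
  \<open>{1..I1}\<close> and column index in \<open>{1..I2}\<close> are ever referred to.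
\<close>

definition positive_table :: "nat \<Rightarrow> nat \<Rightarrow> (nat \<Rightarrow> nat \<Rightarrow> real) \<Rightarrow> bool" where
  "positive_table I1 I2 p \<longleftrightarrow>
     (\<forall>i\<in>{1..I1}. \<forall>j\<in>{1..I2}. 0 < p i j) \<and> (\<Sum>i=1..I1. \<Sum>j=1..I2. p i j) = 1"

definition row_marginal :: "nat \<Rightarrow> (nat \<Rightarrow> nat \<Rightarrow> real) \<Rightarrow> nat \<Rightarrow> real" where
  "row_marginal I2 p i = (\<Sum>j=1..I2. p i j)"

definition col_marginal :: "nat \<Rightarrow> (nat \<Rightarrow> nat \<Rightarrow> real) \<Rightarrow> nat \<Rightarrow> real" where
  "col_marginal I1 p j = (\<Sum>i=1..I1. p i j)"

definition pearson_ratio ::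
  "nat \<Rightarrow> nat \<Rightarrow> (nat \<Rightarrow> nat \<Rightarrow> real) \<Rightarrow> nat \<Rightarrow> nat \<Rightarrow> real" where
  "pearson_ratio I1 I2 p i j = p i j / (row_marginal I2 p i * col_marginal I1 p j)"

text \<open>
  The scale \<open>F\<close> is the derivative of \<open>\<phi>\<close>, and it is meaningful only on the open half-line
  \<open>{0<..}\<close>; its inverse \<open>G\<close> accordingly has domain \<open>F ` {0<..}\<close>, which need not be the whole
  real line.
\<close>

definition F_scale :: "(real \<Rightarrow> real) \<Rightarrow> real \<Rightarrow> real" where
  "F_scale \<phi> = deriv \<phi>"

definition G_scale :: "(real \<Rightarrow> real) \<Rightarrow> real \<Rightarrow> real" where
  "G_scale \<phi> = the_inv_into {0<..} (F_scale \<phi>)"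

definition phi_generator :: "(real \<Rightarrow> real) \<Rightarrow> bool" where
  "phi_generator \<phi> \<longleftrightarrow>
     convex_on {0..} \<phi> \<and> \<phi> differentiable_on {0<..} \<and>
     \<phi> 1 = 0 \<and> F_scale \<phi> 1 = 0 \<and> strict_mono_on {0<..} (F_scale \<phi>)"

text \<open>
  Since the inverse constant is total, the model equation has to be accompanied by the requirement
  that the linear predictor lies in the domain of \<open>G\<close>.
\<close>

definition RC_model ::
  "(real \<Rightarrow> real) \<Rightarrow> nat \<Rightarrow> nat \<Rightarrow> nat \<Rightarrow> (nat \<Rightarrow> nat \<Rightarrow> real) \<Rightarrow> bool" where
  "RC_model \<phi> I1 I2 K p \<longleftrightarrow>
     (\<exists>(\<alpha> :: nat \<Rightarrow> real) (\<beta> :: nat \<Rightarrow> real) (\<psi> :: nat \<Rightarrow> real)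
       (\<mu> :: nat \<Rightarrow> nat \<Rightarrow> real) (\<nu> :: nat \<Rightarrow> nat \<Rightarrow> real).
       \<forall>i\<in>{1..I1}. \<forall>j\<in>{1..I2}.
         \<alpha> i + \<beta> j + (\<Sum>k=1..K. \<psi> k * \<mu> k i * \<nu> k j) \<in> F_scale \<phi> ` {0<..} \<and>
         p i j = row_marginal I2 p i * col_marginal I1 p j *
                   G_scale \<phi> (\<alpha> i + \<beta> j + (\<Sum>k=1..K. \<psi> k * \<mu> k i * \<nu> k j)))"

definition gamma_LL ::
  "(real \<Rightarrow> real) \<Rightarrow> nat \<Rightarrow> nat \<Rightarrow> (nat \<Rightarrow> nat \<Rightarrow> real) \<Rightarrow> nat \<Rightarrow> nat \<Rightarrow> real" where
  "gamma_LL \<phi> I1 I2 p i j =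
     F_scale \<phi> (pearson_ratio I1 I2 p (i+1) (j+1)) - F_scale \<phi> (pearson_ratio I1 I2 p (i+1) j)
     - F_scale \<phi> (pearson_ratio I1 I2 p i (j+1)) + F_scale \<phi> (pearson_ratio I1 I2 p i j)"

definition eta_LG :: "nat \<Rightarrow> (nat \<Rightarrow> nat \<Rightarrow> real) \<Rightarrow> nat \<Rightarrow> nat \<Rightarrow> real" where
  "eta_LG I2 p i j =
     ln (((\<Sum>h\<in>{j<..I2}. p (i+1) h) * (\<Sum>h\<in>{1..j}. p i h)) /
         ((\<Sum>h\<in>{j<..I2}. p i h) * (\<Sum>h\<in>{1..j}. p (i+1) h)))"

definition eta_GL :: "nat \<Rightarrow> (nat \<Rightarrow> nat \<Rightarrow> real) \<Rightarrow> nat \<Rightarrow> nat \<Rightarrow> real" where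
  "eta_GL I1 p i j =
     ln (((\<Sum>h\<in>{i<..I1}. p h (j+1)) * (\<Sum>h\<in>{1..i}. p h j)) /
         ((\<Sum>h\<in>{1..i}. p h (j+1)) * (\<Sum>h\<in>{i<..I1}. p h j)))"

end

theory Submission imports Defs begin

text \<open>
  Non negative \<open>LL\<close> interactions say that, on the \<open>F\<close> scale, the difference of the ratios
  \<open>\<pi>\<^sub>i\<^sub>j / (\<pi>\<^sub>i\<^sub>+ \<pi>\<^sub>+\<^sub>j)\<close> of two consecutive rows increases along the columns. As \<open>F\<close> is strictly
  increasing, the difference of the ratios themselves changes sign at most once, from negative to
  positive. Weighted by the column marginals it sums to zero, because both conditional row
  distributions have total mass one; hence all its partial sums are non positive, which is the
  stochastic ordering of the two conditional distributions expressed by \<open>\<eta>\<^sub>L\<^sub>G \<ge> 0\<close>. Exchanging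
  the two margins gives \<open>\<eta>\<^sub>G\<^sub>L \<ge> 0\<close>.
\<close>

text \<open>A positive head sum contains a positive term, so by \<open>cross\<close> every term
  beyond \<open>m\<close> is non negative and the total would be positive.\<close>

lemma head_sum_nonpos_of_single_crossing:
  fixes d :: "nat \<Rightarrow> real"
  assumes total: "(\<Sum>h=1..n. d h) = 0" and "m \<le> n"
    and cross: "\<And>k l. 1 \<le> k \<Longrightarrow> k \<le> l \<Longrightarrow> l \<le> n \<Longrightarrow> 0 < d k \<Longrightarrow> 0 \<le> d l"
  shows "(\<Sum>h=1..m. d h) \<le> 0"
proof (rule ccontr)
  assume pos: "\<not> (\<Sum>h=1..m. d h) \<le> 0"
  then obtain k where k: "k \<in> {1..m}" "0 < d k"
    using sum_nonpos[of "{1..m}" d] by force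
  have "0 \<le> (\<Sum>h\<in>{m<..n}. d h)"
    using k cross \<open>m \<le> n\<close> by (intro sum_nonneg) auto
  moreover have "(\<Sum>h=1..n. d h) = (\<Sum>h=1..m. d h) + (\<Sum>h\<in>{m<..n}. d h)"
    using \<open>m \<le> n\<close> by (subst sum.union_disjoint[symmetric]) (auto intro: sum.cong)
  ultimately show False using pos total by linarith
qed

text \<open>Common form of the \<open>LG\<close> and \<open>GL\<close> cases: \<open>a\<close> and
  \<open>b\<close> are two adjacent rows (or columns) with totals \<open>A\<close> and
  \<open>B\<close>, and \<open>w\<close> is the opposite marginal. Hypothesis \<open>incr\<close> is
  \<gamma> \<ge> 0 rearranged.\<close>

lemma global_log_odds_ratio_nonneg:
  fixes F :: "real \<Rightarrow> real" and a b w :: "nat \<Rightarrow> real"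
  assumes F: "strict_mono_on {0<..} F"
    and pos: "\<And>h. h \<in> {1..n} \<Longrightarrow> 0 < a h \<and> 0 < b h \<and> 0 < w h"
    and A: "A = (\<Sum>h=1..n. a h)" and B: "B = (\<Sum>h=1..n. b h)"
    and incr: "\<And>h. h \<in> {1..<n} \<Longrightarrow>
      F (b h / (B * w h)) - F (a h / (A * w h))
        \<le> F (b (Suc h) / (B * w (Suc h))) - F (a (Suc h) / (A * w (Suc h)))"
    and m: "m \<in> {1..<n}"
  shows "0 \<le> ln (((\<Sum>h\<in>{m<..n}. b h) * (\<Sum>h\<in>{1..m}. a h)) /
                 ((\<Sum>h\<in>{m<..n}. a h) * (\<Sum>h\<in>{1..m}. b h)))"
proof -
  have AB: "0 < A" "0 < B"
    unfolding A B using pos m by (auto intro!: sum_pos)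
  define d where "d h = b h / B - a h / A" for h
  \<comment> \<open>\<open>d h\<close> is \<open>w h\<close> > 0 times the difference of the two
    ratios, and \<open>F\<close> preserves strict order.\<close>
  have sign: "0 < d h \<longleftrightarrow> 0 < F (b h / (B * w h)) - F (a h / (A * w h))" if h: "h \<in> {1..n}" for h
  proof -
    have "d h = w h * (b h / (B * w h) - a h / (A * w h))"
      using pos[OF h] AB by (simp add: d_def field_simps)
    then have "0 < d h \<longleftrightarrow> a h / (A * w h) < b h / (B * w h)"
      using pos[OF h] by (simp add: zero_less_mult_iff)
    also have "\<dots> \<longleftrightarrow> F (a h / (A * w h)) < F (b h / (B * w h))"
      using pos[OF h] AB by (intro strict_mono_on_less[OF F, symmetric]) auto
    finally show ?thesis by simp
  qed
  have mono: "F (b k / (B * w k)) - F (a k / (A * w k)) \<le> F (b l / (B * w l)) - F (a l / (A * w l))"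
    if "1 \<le> k" "k \<le> l" "l \<le> n" for k l
    using that(2,1,3)
  proof (induction l rule: dec_induct)
    case (step l)
    then show ?case using incr[of l] by fastforce
  qed simp
  have split: "(\<Sum>h=1..n. f h) = (\<Sum>h=1..m. f h) + (\<Sum>h\<in>{m<..n}. f h)" for f :: "nat \<Rightarrow> real"
    using m by (subst sum.union_disjoint[symmetric]) (auto intro: sum.cong)
  have "(\<Sum>h=1..m. d h) \<le> 0"
  proof (rule head_sum_nonpos_of_single_crossing)
    show "(\<Sum>h=1..n. d h) = 0"
      using AB A B by (simp add: d_def sum_subtractf flip: sum_divide_distrib)
    fix k l assume kl: "1 \<le> k" "k \<le> l" "l \<le> n" "0 < d k"
    then have "0 < d l" using sign[of k] sign[of l] mono[of k l] by auto
    then show "0 \<le> d l" by simp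
  qed (use m in simp)
  then have "(\<Sum>h=1..m. b h) / B \<le> (\<Sum>h=1..m. a h) / A"
    by (simp add: d_def sum_subtractf sum_divide_distrib)
  then have "(\<Sum>h=1..m. b h) * A \<le> (\<Sum>h=1..m. a h) * B"
    using AB by (simp add: field_simps)
  \<comment> \<open>With \<open>A\<close> and \<open>B\<close> split into head and tail, the product
    of the two heads occurs on both sides and cancels.\<close>
  then have le: "(\<Sum>h\<in>{m<..n}. a h) * (\<Sum>h=1..m. b h) \<le> (\<Sum>h\<in>{m<..n}. b h) * (\<Sum>h=1..m. a h)"
    unfolding A B split by (simp add: algebra_simps)
  have "0 < (\<Sum>h\<in>{m<..n}. a h)" "0 < (\<Sum>h=1..m. b h)"
    using pos m by (auto intro!: sum_pos)
  then show ?thesis using le by (intro ln_ge_zero) (simp add: le_divide_eq_1)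
qed

theorem proposition5:
  fixes \<phi> :: "real \<Rightarrow> real" and p :: "nat \<Rightarrow> nat \<Rightarrow> real" and I1 I2 K :: nat
  assumes "phi_generator \<phi>"
    and "I1 \<ge> 2" and "I2 \<ge> 2"
    and "positive_table I1 I2 p"
    and "RC_model \<phi> I1 I2 K p"
    and "\<And>i j. i \<in> {1..<I1} \<Longrightarrow> j \<in> {1..<I2} \<Longrightarrow> gamma_LL \<phi> I1 I2 p i j \<ge> 0"
  shows "\<forall>i\<in>{1..<I1}. \<forall>j\<in>{1..<I2}. eta_LG I2 p i j \<ge> 0 \<and> eta_GL I1 p i j \<ge> 0"
proof (intro ballI)
  fix i j assume i: "i \<in> {1..<I1}" and j: "j \<in> {1..<I2}"
  have F: "strict_mono_on {0<..} (F_scale \<phi>)"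
    using assms(1) by (simp add: phi_generator_def)
  have p: "0 < p i j" if "i \<in> {1..I1}" "j \<in> {1..I2}" for i j
    using assms(4) that by (simp add: positive_table_def)
  have row: "0 < row_marginal I2 p i" if "i \<in> {1..I1}" for i
    unfolding row_marginal_def using p that assms(3) by (intro sum_pos) auto
  have col: "0 < col_marginal I1 p j" if "j \<in> {1..I2}" for j
    unfolding col_marginal_def using p that assms(2) by (intro sum_pos) auto
  have "eta_LG I2 p i j \<ge> 0"
    unfolding eta_LG_def
  proof (rule global_log_odds_ratio_nonneg[OF F, where w = "col_marginal I1 p"])
    fix h assume "h \<in> {1..<I2}"
    then show "F_scale \<phi> (p (i+1) h / (row_marginal I2 p (i+1) * col_marginal I1 p h))
        - F_scale \<phi> (p i h / (row_marginal I2 p i * col_marginal I1 p h))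
      \<le> F_scale \<phi> (p (i+1) (Suc h) / (row_marginal I2 p (i+1) * col_marginal I1 p (Suc h)))
        - F_scale \<phi> (p i (Suc h) / (row_marginal I2 p i * col_marginal I1 p (Suc h)))"
      using assms(6)[OF i, of h] by (simp add: gamma_LL_def pearson_ratio_def)
  qed (use i j p col in \<open>auto simp: row_marginal_def\<close>)
  moreover have "eta_GL I1 p i j \<ge> 0"
    \<comment> \<open>The denominator of \<open>eta_GL\<close> lists its factors in the opposite
      order to \<open>eta_LG\<close>; swapping them matches the lemma, with columns \<open>j\<close>
      and \<open>j+1\<close> as \<open>a\<close> and \<open>b\<close>.\<close>
    unfolding eta_GL_def mult.commute[of "\<Sum>h\<in>{1..i}. p h (j+1)"]
  proof (rule global_log_odds_ratio_nonneg[OF F, where w = "row_marginal I2 p"])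
    fix h assume "h \<in> {1..<I1}"
    then show "F_scale \<phi> (p h (j+1) / (col_marginal I1 p (j+1) * row_marginal I2 p h))
        - F_scale \<phi> (p h j / (col_marginal I1 p j * row_marginal I2 p h))
      \<le> F_scale \<phi> (p (Suc h) (j+1) / (col_marginal I1 p (j+1) * row_marginal I2 p (Suc h)))
        - F_scale \<phi> (p (Suc h) j / (col_marginal I1 p j * row_marginal I2 p (Suc h)))"
      using assms(6)[OF _ j, of h] by (simp add: gamma_LL_def pearson_ratio_def mult.commute)
  qed (use i j p row in \<open>auto simp: col_marginal_def\<close>)
  ultimately show "eta_LG I2 p i j \<ge> 0 \<and> eta_GL I1 p i j \<ge> 0" by simp
qed

end
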